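(* Let $M$ be a connected surface in $E^3$ without parabolic points (i.e. its Gauss curvature $K$ vanishes nowhere). Then $M$ is of $III$-type $1$ if and only if $M$ is part of a sphere.
   Context: $M$ is a connected (sufficiently differentiable) surface in Euclidean 3-space $E^3$ with position vector $x=x(u^1,u^2)$ and Gauss map (unit normal) $n:M\to S^2$. The third fundamental form is $III=e_{ij}\,du^i\,du^j$ with $e_{ij}=\langle n_{/i},n_{/j}\rangle$, where $/i$ denotes $\partial/\partial u^i$; since $K\neq0$ it is nondegenerate, and $(e^{ij})$ denotes the inverse of $(e_{ij})$. The second Beltrami operator with respect to $III$ is $\Delta^{III}\varphi:=-e^{ij}\nabla^{III}_i\varphi_{/j}$, where $\nabla^{III}_i$ is the covariant derivative with respect to $III$ in the $u^i$ direction and repeated indices are summed; it is applied componentwise to vector-valued functions. The surface $M$ is of finite $III$-type if its position vector can be written as $x=c+x_1+\dots+x_m$ with $c$ a constant vector and nonconstant vector-valued functions $x_i$ satisfying $\Delta^{III}x_i=\lambda_i x_i$, where the $\lambda_i$ are eigenvalues of $\Delta^{III}$. When exactly $k$ nonconstant eigenvectors $x_1,\dots,x_k$ appear in this sum and they all belong to different eigenvalues $\lambda_1,\dots,\lambda_k$, $M$ is said to be of $III$-type $k$; when $\lambda_i=0$ for some $i=1,\dots,k$, $M$ is said to be of null $III$-type $k$.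
   Formalization: "III-type 1" is taken to mean type 1 with a nonzero eigenvalue, so null III-type 1 is excluded; otherwise the claim fails for minimal surfaces such as Enneper's, which satisfy Δ^III x = 0 with K nowhere zero. *)

theory Defs
  imports "HOL-Analysis.Analysis"
begin

section \<open>Coordinate calculus on open subsets of the plane\<close>

definition pd :: "2 \<Rightarrow> (real^2 \<Rightarrow> 'b::real_normed_vector) \<Rightarrow> real^2 \<Rightarrow> 'b" where
  "pd i f u = frechet_derivative f (at u) (axis i 1)"

primrec Ck_on :: "nat \<Rightarrow> (real^2 \<Rightarrow> 'b::real_normed_vector) \<Rightarrow> (real^2) set \<Rightarrow> bool" where
  "Ck_on 0 f U \<longleftrightarrow> continuous_on U f"
| "Ck_on (Suc k) f U \<longleftrightarrow> (\<forall>u\<in>U. f differentiable (at u)) \<and> (\<forall>i. Ck_on k (pd i f) U)"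

text \<open>A metric is given by its coefficient matrix \<open>e\<close>; \<open>christoffel e k i j\<close> has upper index \<open>k\<close>
  and lower indices \<open>i\<close>, \<open>j\<close>.\<close>

definition christoffel :: "(real^2 \<Rightarrow> real^2^2) \<Rightarrow> 2 \<Rightarrow> 2 \<Rightarrow> 2 \<Rightarrow> real^2 \<Rightarrow> real" where
  "christoffel e k i j u =
     (\<Sum>l\<in>UNIV. matrix_inv (e u) $ k $ l *
        (pd i (\<lambda>v. e v $ j $ l) u + pd j (\<lambda>v. e v $ i $ l) u - pd l (\<lambda>v. e v $ i $ j) u)) / 2"

text \<open>The \<open>j\<close>-th component of the covariant derivative, in the \<open>u\<^sup>i\<close> direction, of the covector
  field with components \<open>\<omega> 1\<close>, \<open>\<omega> 2\<close>.\<close>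

definition cov_deriv ::
  "(real^2 \<Rightarrow> real^2^2) \<Rightarrow> 2 \<Rightarrow> (2 \<Rightarrow> real^2 \<Rightarrow> real) \<Rightarrow> 2 \<Rightarrow> real^2 \<Rightarrow> real" where
  "cov_deriv e i \<omega> j u = pd i (\<omega> j) u - (\<Sum>k\<in>UNIV. christoffel e k i j u * \<omega> k u)"

definition beltrami2 :: "(real^2 \<Rightarrow> real^2^2) \<Rightarrow> (real^2 \<Rightarrow> real) \<Rightarrow> real^2 \<Rightarrow> real" where
  "beltrami2 e f u =
     - (\<Sum>i\<in>UNIV. \<Sum>j\<in>UNIV. matrix_inv (e u) $ i $ j * cov_deriv e i (\<lambda>k. pd k f) j u)"

definition beltrami2_vec :: "(real^2 \<Rightarrow> real^2^2) \<Rightarrow> (real^2 \<Rightarrow> real^3) \<Rightarrow> real^2 \<Rightarrow> real^3" where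
  "beltrami2_vec e f u = (\<chi> a. beltrami2 e (\<lambda>v. f v $ a) u)"

section \<open>Surfaces in Euclidean 3-space\<close>

text \<open>An (immersed) surface is an abstract topological surface \<open>M\<close> together with its position
  vector \<open>x\<close>; self-intersections of the image are allowed, and an embedded surface is the case
  where \<open>x\<close> is the inclusion map.  No separate atlas is needed: a local homeomorphism \<open>\<phi>\<close> from the
  plane to \<open>M\<close> is an admissible parametrization when \<open>x \<circ> \<phi>\<close> is a regular map of class \<open>C\<^sup>3\<close>, and
  changes of such parametrizations are then automatically of class \<open>C\<^sup>3\<close>.  The class \<open>C\<^sup>3\<close>
  is what makes the second Beltrami operator of the third fundamental form meaningful: it involves
  first derivatives of \<open>e\<^sub>i\<^sub>j\<close>, hence second derivatives of the unit normal.\<close>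

definition local_param ::
  "'a topology \<Rightarrow> ('a \<Rightarrow> real^3) \<Rightarrow> (real^2) set \<Rightarrow> (real^2 \<Rightarrow> 'a) \<Rightarrow> bool" where
  "local_param M x U \<phi> \<longleftrightarrow>
     open U \<and> openin M (\<phi> ` U) \<and>
     homeomorphic_map (top_of_set U) (subtopology M (\<phi> ` U)) \<phi> \<and>
     Ck_on 3 (x \<circ> \<phi>) U \<and>
     (\<forall>u\<in>U. cross3 (pd 1 (x \<circ> \<phi>) u) (pd 2 (x \<circ> \<phi>) u) \<noteq> 0)"

definition surface :: "'a topology \<Rightarrow> ('a \<Rightarrow> real^3) \<Rightarrow> bool" where
  "surface M x \<longleftrightarrow>
     topspace M \<noteq> {} \<and> Hausdorff_space M \<and> second_countable M \<and>
     (\<forall>p\<in>topspace M. \<exists>U \<phi>. local_param M x U \<phi> \<and> p \<in> \<phi> ` U)"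

definition gauss_map :: "'a topology \<Rightarrow> ('a \<Rightarrow> real^3) \<Rightarrow> ('a \<Rightarrow> real^3) \<Rightarrow> bool" where
  "gauss_map M x n \<longleftrightarrow>
     continuous_map M (top_of_set (sphere 0 1)) n \<and>
     (\<forall>U \<phi>. local_param M x U \<phi> \<longrightarrow> (\<forall>u\<in>U. \<forall>i. n (\<phi> u) \<bullet> pd i (x \<circ> \<phi>) u = 0))"

text \<open>In the following, \<open>y\<close> and \<open>\<nu>\<close> are the position vector and the unit normal expressed in
  local coordinates.\<close>

definition form1 :: "(real^2 \<Rightarrow> real^3) \<Rightarrow> real^2 \<Rightarrow> real^2^2" where
  "form1 y u = (\<chi> i j. pd i y u \<bullet> pd j y u)"

definition form2 :: "(real^2 \<Rightarrow> real^3) \<Rightarrow> (real^2 \<Rightarrow> real^3) \<Rightarrow> real^2 \<Rightarrow> real^2^2" where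
  "form2 y \<nu> u = (\<chi> i j. pd i (pd j y) u \<bullet> \<nu> u)"

definition form3 :: "(real^2 \<Rightarrow> real^3) \<Rightarrow> real^2 \<Rightarrow> real^2^2" where
  "form3 \<nu> u = (\<chi> i j. pd i \<nu> u \<bullet> pd j \<nu> u)"

definition gauss_curvature :: "(real^2 \<Rightarrow> real^3) \<Rightarrow> (real^2 \<Rightarrow> real^3) \<Rightarrow> real^2 \<Rightarrow> real" where
  "gauss_curvature y \<nu> u = det (form2 y \<nu> u) / det (form1 y u)"

definition no_parabolic_points :: "'a topology \<Rightarrow> ('a \<Rightarrow> real^3) \<Rightarrow> ('a \<Rightarrow> real^3) \<Rightarrow> bool" where
  "no_parabolic_points M x n \<longleftrightarrow>
     (\<forall>U \<phi>. local_param M x U \<phi> \<longrightarrow> (\<forall>u\<in>U. gauss_curvature (x \<circ> \<phi>) (n \<circ> \<phi>) u \<noteq> 0))"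

section \<open>Surfaces of finite III-type\<close>

text \<open>The equation \<open>\<Delta>\<^sup>I\<^sup>I\<^sup>I f = \<lambda> f\<close> on \<open>M\<close> for a vector-valued function \<open>f\<close> of class \<open>C\<^sup>2\<close>; the
  operator does not depend on the parametrization, so it is required in all of them.\<close>

definition III_eigen ::
  "'a topology \<Rightarrow> ('a \<Rightarrow> real^3) \<Rightarrow> ('a \<Rightarrow> real^3) \<Rightarrow> real \<Rightarrow> ('a \<Rightarrow> real^3) \<Rightarrow> bool" where
  "III_eigen M x n l f \<longleftrightarrow>
     (\<forall>U \<phi>. local_param M x U \<phi> \<longrightarrow>
        Ck_on 2 (f \<circ> \<phi>) U \<and>
        (\<forall>u\<in>U. beltrami2_vec (form3 (n \<circ> \<phi>)) (f \<circ> \<phi>) u = l *\<^sub>R f (\<phi> u)))"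

definition III_decomposition ::
  "'a topology \<Rightarrow> ('a \<Rightarrow> real^3) \<Rightarrow> ('a \<Rightarrow> real^3) \<Rightarrow> nat \<Rightarrow>
   real^3 \<Rightarrow> (nat \<Rightarrow> 'a \<Rightarrow> real^3) \<Rightarrow> (nat \<Rightarrow> real) \<Rightarrow> bool" where
  "III_decomposition M x n k c f l \<longleftrightarrow>
     (\<forall>p\<in>topspace M. x p = c + (\<Sum>i<k. f i p)) \<and>
     (\<forall>i<k. \<not> f i constant_on topspace M \<and> III_eigen M x n (l i) (f i)) \<and>
     inj_on l {..<k}"

text \<open>Convention: ``III-type \<open>k\<close>'' without further qualification is kept separate from ``null III-type
  \<open>k\<close>'', i.e. none of the \<open>k\<close> eigenvalues vanishes.  The distinction matters: a minimal surface
  satisfies \<open>\<Delta>\<^sup>I\<^sup>I\<^sup>I x = 0\<close> and is thus of null III-type 1.\<close>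

definition III_type ::
  "'a topology \<Rightarrow> ('a \<Rightarrow> real^3) \<Rightarrow> ('a \<Rightarrow> real^3) \<Rightarrow> nat \<Rightarrow> bool" where
  "III_type M x n k \<longleftrightarrow>
     (\<exists>c f l. III_decomposition M x n k c f l \<and> (\<forall>i<k. l i \<noteq> 0))"

definition null_III_type ::
  "'a topology \<Rightarrow> ('a \<Rightarrow> real^3) \<Rightarrow> ('a \<Rightarrow> real^3) \<Rightarrow> nat \<Rightarrow> bool" where
  "null_III_type M x n k \<longleftrightarrow>
     (\<exists>c f l. III_decomposition M x n k c f l \<and> (\<exists>i<k. l i = 0))"

definition part_of_sphere :: "'a topology \<Rightarrow> ('a \<Rightarrow> real^3) \<Rightarrow> bool" where
  "part_of_sphere M x \<longleftrightarrow> (\<exists>c r. r > 0 \<and> x ` topspace M \<subseteq> sphere c r)"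

end

theory Submission
  imports Defs
begin

text \<open>Parametrize by the unit normal \<open>\<nu>\<close>, whose first fundamental form is \<open>III\<close>. For a vector field
  \<open>f\<close> with \<open>f\<^sub>i\<close> orthogonal to \<open>\<nu>\<close>, put \<open>h\<^sub>i\<^sub>j = \<langle>f\<^sub>i, \<nu>\<^sub>j\<rangle>\<close>. Its trace \<open>R\<close> with respect to \<open>III\<close>
  is \<open>\<langle>\<Delta>f, \<nu>\<rangle>\<close>, and the Codazzi equation for \<open>h\<close> gives \<open>\<langle>\<Delta>f, \<nu>\<^sub>l\<rangle> = - R\<^sub>l\<close>. If \<open>f = x - c\<close>
  satisfies \<open>\<Delta>f = \<lambda> f\<close>, then \<open>R = \<lambda> \<langle>f, \<nu>\<rangle>\<close> and so \<open>R\<^sub>l = \<lambda> \<langle>f, \<nu>\<^sub>l\<rangle>\<close>, whence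
  \<open>\<lambda> \<langle>f, \<nu>\<^sub>l\<rangle> = - \<lambda> \<langle>f, \<nu>\<^sub>l\<rangle> = 0\<close>. As \<open>\<lambda> \<noteq> 0\<close>, \<open>f\<close> is normal to the surface, so \<open>|f|\<close> is
  locally constant. Conversely \<open>\<Delta>\<nu> = 2 \<nu>\<close>, and on a sphere \<open>x - c = \<plusminus> r \<nu>\<close>.\<close>

section \<open>Partial derivatives and the classes \<open>C\<^sup>k\<close>\<close>

lemma pd_eq_has_derivative:
  "(f has_derivative f') (at u) \<Longrightarrow> pd i f u = f' (axis i 1)"
  by (simp add: pd_def frechet_derivative_at[symmetric])

lemma has_derivative_frechet:
  "f differentiable (at u) \<Longrightarrow> (f has_derivative frechet_derivative f (at u)) (at u)"
  by (simp add: frechet_derivative_works)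

lemma differentiable_cong_open:
  assumes "open U" "u \<in> U" "\<And>v. v \<in> U \<Longrightarrow> f v = g v"
  shows "f differentiable (at u) \<longleftrightarrow> g differentiable (at u)"
  unfolding differentiable_def
  by (metis assms has_derivative_transform_within_open)

text \<open>\<open>frechet_derivative\<close> is a choice among all derivatives at \<open>u\<close>,
  and functions that agree near \<open>u\<close> have the same ones; so the values agree even where
  no derivative exists.\<close>

lemma pd_cong_open:
  assumes "open U" "u \<in> U" "\<And>v. v \<in> U \<Longrightarrow> f v = g v"
  shows "pd i f u = pd i g u"
proof -
  have "(\<lambda>f'. (f has_derivative f') (at u)) = (\<lambda>f'. (g has_derivative f') (at u))"
    using assms by (metis has_derivative_transform_within_open)
  then show ?thesis
    by (simp add: pd_def frechet_derivative_def)
qed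

lemma pd_const [simp]: "pd i (\<lambda>v. c) u = 0"
  by (simp add: pd_def)

lemma pd_bounded_linear:
  assumes "bounded_linear L" "f differentiable (at u)"
  shows "pd i (\<lambda>v. L (f v)) u = L (pd i f u)"
proof -
  have "((\<lambda>v. L (f v)) has_derivative (\<lambda>h. L (frechet_derivative f (at u) h))) (at u)"
    by (rule bounded_linear.has_derivative[OF assms(1) has_derivative_frechet[OF assms(2)]])
  from pd_eq_has_derivative[OF this] show ?thesis by (simp add: pd_def)
qed

lemma pd_bounded_bilinear:
  assumes "bounded_bilinear P" "f differentiable (at u)" "g differentiable (at u)"
  shows "pd i (\<lambda>v. P (f v) (g v)) u = P (f u) (pd i g u) + P (pd i f u) (g u)"
  using pd_eq_has_derivative[OF bounded_bilinear.FDERIV[OF assms(1)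
      has_derivative_frechet[OF assms(2)] has_derivative_frechet[OF assms(3)]]]
  by (simp add: pd_def)

lemma bounded_bilinear_differentiable:
  assumes "bounded_bilinear P" "f differentiable (at u)" "g differentiable (at u)"
  shows "(\<lambda>v. P (f v) (g v)) differentiable (at u)"
  using bounded_bilinear.FDERIV[OF assms(1)
      has_derivative_frechet[OF assms(2)] has_derivative_frechet[OF assms(3)]]
  by (rule differentiableI)

lemma pd_add:
  assumes "f differentiable (at u)" "g differentiable (at u)"
  shows "pd i (\<lambda>v. f v + g v) u = pd i f u + pd i g u"
  using pd_eq_has_derivative[OF has_derivative_add[OF
      has_derivative_frechet[OF assms(1)] has_derivative_frechet[OF assms(2)]]]
  by (simp add: pd_def)

lemma pd_diff:
  assumes "f differentiable (at u)" "g differentiable (at u)"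
  shows "pd i (\<lambda>v. f v - g v) u = pd i f u - pd i g u"
  using pd_eq_has_derivative[OF has_derivative_diff[OF
      has_derivative_frechet[OF assms(1)] has_derivative_frechet[OF assms(2)]]]
  by (simp add: pd_def)

lemmas pd_inner = pd_bounded_bilinear[OF bounded_bilinear_inner]
lemmas pd_mult = pd_bounded_bilinear[OF bounded_bilinear_mult]
lemmas pd_scaleR_right = pd_bounded_linear[OF bounded_linear_scaleR_right]
lemmas pd_vec_nth = pd_bounded_linear[OF bounded_linear_vec_nth]

lemma bounded_bilinear_cross3: "bounded_bilinear cross3"
  using bilinear_cross by (simp add: bilinear_conv_bounded_bilinear)

section \<open>Closure properties of the classes C^k\<close>

lemma Ck_on_cong:
  assumes "open U"
  shows "(\<And>v. v \<in> U \<Longrightarrow> f v = g v) \<Longrightarrow> Ck_on k f U \<longleftrightarrow> Ck_on k g U"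
proof (induction k arbitrary: f g)
  case 0
  then show ?case by (simp cong: continuous_on_cong)
next
  case (Suc k)
  have "pd i f v = pd i g v" if "v \<in> U" for i v
    using pd_cong_open[OF assms that Suc.prems] .
  with Suc.IH have "Ck_on k (pd i f) U \<longleftrightarrow> Ck_on k (pd i g) U" for i by blast
  then show ?case
    using differentiable_cong_open[OF assms _ Suc.prems] by simp
qed

lemma Ck_on_SucD: "Ck_on (Suc k) f U \<Longrightarrow> Ck_on k f U"
proof (induction k arbitrary: f)
  case 0
  then show ?case
    by (auto intro!: continuous_at_imp_continuous_on differentiable_imp_continuous_within)
next
  case (Suc k)
  then show ?case by (metis Ck_on.simps(2))
qed

lemma Ck_on_imp_continuous_on: "Ck_on k f U \<Longrightarrow> continuous_on U f"
  by (induction k) (auto dest: Ck_on_SucD simp del: Ck_on.simps(2))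

lemma Ck_on_subset: "Ck_on k f U \<Longrightarrow> V \<subseteq> U \<Longrightarrow> Ck_on k f V"
  by (induction k arbitrary: f) (auto intro: continuous_on_subset)

text \<open>Serves the Gauss map, which is only locally, up to a sign, an explicit expression in the
  derivatives of the position vector.\<close>

lemma Ck_on_locally:
  assumes "\<And>u. u \<in> U \<Longrightarrow> \<exists>V. open V \<and> u \<in> V \<and> Ck_on k f V"
  shows "Ck_on k f U"
  using assms
proof (induction k arbitrary: f)
  case 0
  have "isCont f u" if "u \<in> U" for u
    using 0[OF that] by (auto simp: continuous_on_eq_continuous_at)
  then show ?case by (simp add: continuous_at_imp_continuous_on)
next
  case (Suc k)
  have "f differentiable (at u)" if "u \<in> U" for u
    using Suc.prems[OF that] by auto
  moreover have "Ck_on k (pd i f) U" for i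
    using Suc.prems by (intro Suc.IH) (meson Ck_on.simps(2))
  ultimately show ?case by simp
qed

lemma Ck_on_const: "open U \<Longrightarrow> Ck_on k (\<lambda>v. c) U"
proof (induction k arbitrary: c)
  case (Suc k)
  have "pd i (\<lambda>v. c) = (\<lambda>v. 0)" for i by (simp add: fun_eq_iff)
  with Suc show ?case by simp
qed simp

lemma Ck_on_add:
  assumes "open U"
  shows "Ck_on k f U \<Longrightarrow> Ck_on k g U \<Longrightarrow> Ck_on k (\<lambda>v. f v + g v) U"
proof (induction k arbitrary: f g)
  case 0
  then show ?case by (simp add: continuous_on_add)
next
  case (Suc k)
  have "Ck_on k (pd i (\<lambda>v. f v + g v)) U" for i
  proof (subst Ck_on_cong[OF assms])
    show "pd i (\<lambda>v. f v + g v) v = pd i f v + pd i g v" if "v \<in> U" for v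
      using Suc.prems that by (intro pd_add) auto
    show "Ck_on k (\<lambda>v. pd i f v + pd i g v) U"
      using Suc by simp
  qed
  with Suc.prems show ?case by (simp add: differentiable_add)
qed

text \<open>A single induction by the Leibniz rule covers real, inner and cross products and scalar
  multiplication.\<close>

lemma Ck_on_bounded_bilinear:
  assumes "open U" "bounded_bilinear P"
  shows "Ck_on k f U \<Longrightarrow> Ck_on k g U \<Longrightarrow> Ck_on k (\<lambda>v. P (f v) (g v)) U"
proof (induction k arbitrary: f g)
  case 0
  then show ?case by (simp add: bounded_bilinear.continuous_on[OF assms(2)])
next
  case (Suc k)
  have "Ck_on k (pd i (\<lambda>v. P (f v) (g v))) U" for i
  proof (subst Ck_on_cong[OF assms(1)])
    show "pd i (\<lambda>v. P (f v) (g v)) v = P (f v) (pd i g v) + P (pd i f v) (g v)" if "v \<in> U" for v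
      using Suc.prems that by (intro pd_bounded_bilinear[OF assms(2)]) auto
    have "Ck_on k f U" "Ck_on k g U" "Ck_on k (pd i f) U" "Ck_on k (pd i g) U"
      using Suc.prems Ck_on_SucD by auto
    then show "Ck_on k (\<lambda>v. P (f v) (pd i g v) + P (pd i f v) (g v)) U"
      by (intro Ck_on_add[OF assms(1)] Suc.IH)
  qed
  with Suc.prems show ?case by (simp add: bounded_bilinear_differentiable[OF assms(2)])
qed

text \<open>Each differentiation lowers the exponent by one, so \<open>a\<close> varies in the
  induction. The exponent \<open>- 1 / 2\<close> later normalizes a vector field.\<close>

lemma Ck_on_powr:
  fixes h :: "real^2 \<Rightarrow> real"
  assumes "open U" "\<And>v. v \<in> U \<Longrightarrow> h v > 0"
  shows "Ck_on k h U \<Longrightarrow> Ck_on k (\<lambda>v. h v powr a) U"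
proof (induction k arbitrary: a)
  case 0
  then show ?case using assms(2) by (force intro!: continuous_on_powr)
next
  case (Suc k)
  have D: "((\<lambda>v. h v powr a) has_derivative
      (\<lambda>w. a * h v powr (a - 1) * frechet_derivative h (at v) w)) (at v)" if v: "v \<in> U" for v
  proof -
    have "((\<lambda>y. y powr a) has_derivative (\<lambda>y. a * h v powr (a - 1) * y)) (at (h v))"
      using has_real_derivative_powr[of "h v" a] assms(2)[OF v]
      by (simp add: has_field_derivative_def)
    from has_derivative_compose[OF has_derivative_frechet[of h v] this] show ?thesis
      using Suc.prems v by simp
  qed
  have "Ck_on k (pd i (\<lambda>v. h v powr a)) U" for i
  proof (subst Ck_on_cong[OF assms(1)])
    show "pd i (\<lambda>v. h v powr a) v = a * (h v powr (a - 1) * pd i h v)" if "v \<in> U" for v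
      using pd_eq_has_derivative[OF D[OF that], of i] by (simp add: pd_def)
    have "Ck_on k h U" "Ck_on k (pd i h) U"
      using Suc.prems Ck_on_SucD by auto
    then show "Ck_on k (\<lambda>v. a * (h v powr (a - 1) * pd i h v)) U"
      using assms(1)
      by (intro Ck_on_bounded_bilinear[OF _ bounded_bilinear_mult] Ck_on_const Suc.IH)
  qed
  with D show ?case by (auto intro: differentiableI)
qed

section \<open>Symmetry of second partial derivatives\<close>

lemma has_vector_derivative_along_axis:
  assumes "f differentiable (at (p + s *\<^sub>R axis i 1))"
  shows "((\<lambda>t. f (p + t *\<^sub>R axis i 1)) has_vector_derivative pd i f (p + s *\<^sub>R axis i 1)) (at s)"
proof -
  have "((\<lambda>t. p + t *\<^sub>R axis i 1) has_derivative (\<lambda>t. t *\<^sub>R axis i 1)) (at s)"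
    by (auto intro!: derivative_eq_intros)
  from has_derivative_compose[OF this has_derivative_frechet[OF assms]]
  have "((\<lambda>t. f (p + t *\<^sub>R axis i 1)) has_derivative
    (\<lambda>t. frechet_derivative f (at (p + s *\<^sub>R axis i 1)) (t *\<^sub>R axis i 1))) (at s)" .
  moreover have "linear (frechet_derivative f (at (p + s *\<^sub>R axis i 1)))"
    using assms by (rule linear_frechet_derivative)
  ultimately show ?thesis
    by (simp add: has_vector_derivative_def pd_def linear_cmul)
qed

text \<open>The mean value theorem is applied twice: to the increment in direction \<open>j\<close>
  as a function of the shift along \<open>i\<close>, then to \<open>pd i g\<close> along
  \<open>j\<close>.\<close>

lemma mixed_difference_eq:
  fixes g :: "real^2 \<Rightarrow> real"
  assumes g: "\<And>v. v \<in> U \<Longrightarrow> g differentiable (at v)"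
    and gi: "\<And>v. v \<in> U \<Longrightarrow> pd i g differentiable (at v)"
    and h: "h > 0"
    and box: "\<And>s t. 0 \<le> s \<Longrightarrow> s \<le> h \<Longrightarrow> 0 \<le> t \<Longrightarrow> t \<le> h \<Longrightarrow> u + s *\<^sub>R axis i 1 + t *\<^sub>R axis j 1 \<in> U"
  shows "\<exists>s t. 0 < s \<and> s < h \<and> 0 < t \<and> t < h \<and>
    g (u + h *\<^sub>R axis i 1 + h *\<^sub>R axis j 1) - g (u + h *\<^sub>R axis i 1) - g (u + h *\<^sub>R axis j 1) + g u
      = h * h * pd j (pd i g) (u + s *\<^sub>R axis i 1 + t *\<^sub>R axis j 1)"
proof -
  let ?a = "axis i (1::real) :: real^2" and ?b = "axis j (1::real) :: real^2"
  let ?F = "\<lambda>s. g ((u + h *\<^sub>R ?b) + s *\<^sub>R ?a) - g (u + s *\<^sub>R ?a)"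
  have "\<exists>s. 0 < s \<and> s < h \<and> ?F h - ?F 0 =
      (h - 0) * (pd i g ((u + h *\<^sub>R ?b) + s *\<^sub>R ?a) - pd i g (u + s *\<^sub>R ?a))"
  proof (rule MVT2[OF h])
    fix s assume s: "0 \<le> s" "s \<le> h"
    have "u + h *\<^sub>R ?b + s *\<^sub>R ?a \<in> U" "u + s *\<^sub>R ?a \<in> U"
      using box[OF s, of h] box[OF s, of 0] h by (auto simp: add_ac)
    then show "(?F has_real_derivative
        (pd i g ((u + h *\<^sub>R ?b) + s *\<^sub>R ?a) - pd i g (u + s *\<^sub>R ?a))) (at s)"
      using g by (intro DERIV_diff)
        (auto simp: has_real_derivative_iff_has_vector_derivative
          intro!: has_vector_derivative_along_axis)
  qed
  then obtain s where s: "0 < s" "s < h" and eq: "?F h - ?F 0 =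
      h * (pd i g ((u + h *\<^sub>R ?b) + s *\<^sub>R ?a) - pd i g (u + s *\<^sub>R ?a))" by auto
  let ?G = "\<lambda>t. pd i g ((u + s *\<^sub>R ?a) + t *\<^sub>R ?b)"
  have "\<exists>t. 0 < t \<and> t < h \<and> ?G h - ?G 0 = (h - 0) * pd j (pd i g) ((u + s *\<^sub>R ?a) + t *\<^sub>R ?b)"
  proof (rule MVT2[OF h])
    fix t assume t: "0 \<le> t" "t \<le> h"
    show "(?G has_real_derivative pd j (pd i g) ((u + s *\<^sub>R ?a) + t *\<^sub>R ?b)) (at t)"
      using box[of s t] s t gi
      by (auto simp: has_real_derivative_iff_has_vector_derivative
          intro!: has_vector_derivative_along_axis)
  qed
  then obtain t where t: "0 < t" "t < h"
    and eq2: "?G h - ?G 0 = h * pd j (pd i g) ((u + s *\<^sub>R ?a) + t *\<^sub>R ?b)" by auto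
  have "?F h - ?F 0 = h * (?G h - ?G 0)"
    unfolding eq by (simp add: add_ac)
  then show ?thesis
    using s t eq2 by (intro exI[of _ s] exI[of _ t]) (simp add: add_ac algebra_simps)
qed

text \<open>Clairaut's theorem. The mixed second difference is symmetric in \<open>i\<close> and
  \<open>j\<close>, so the two mixed derivatives take a common value at suitable points of a small
  square at \<open>u\<close>; continuity carries this over to \<open>u\<close>.\<close>

lemma pd_commute_real:
  fixes g :: "real^2 \<Rightarrow> real"
  assumes U: "open U" "u \<in> U" and g: "Ck_on 2 g U"
  shows "pd i (pd j g) u = pd j (pd i g) u"
proof (rule ccontr)
  assume ne: "pd i (pd j g) u \<noteq> pd j (pd i g) u"
  \<comment> \<open>Half the gap: two errors below \<open>e\<close> cannot bridge it.\<close>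
  define e where "e = \<bar>pd i (pd j g) u - pd j (pd i g) u\<bar> / 2"
  have e: "e > 0" using ne by (simp add: e_def)
  have C: "Ck_on (Suc (Suc 0)) g U" using g by (simp add: numeral_2_eq_2)
  have "\<exists>d>0. \<forall>v. dist v u < d \<longrightarrow> dist (pd i (pd j g) v) (pd i (pd j g) u) < e" for i j
    using C U e by (auto simp: continuous_on_eq_continuous_at continuous_at_eps_delta)
  then obtain d1 d2 where d: "d1 > 0" "d2 > 0"
    and d1: "\<And>v. dist v u < d1 \<Longrightarrow> dist (pd i (pd j g) v) (pd i (pd j g) u) < e"
    and d2: "\<And>v. dist v u < d2 \<Longrightarrow> dist (pd j (pd i g) v) (pd j (pd i g) u) < e"
    by meson
  obtain d3 where d3: "d3 > 0" "ball u d3 \<subseteq> U" using U by (auto elim: openE)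
  \<comment> \<open>Points of the square lie within \<open>2 * h\<close> of \<open>u\<close>, so a
    third of the smallest radius suffices.\<close>
  define h where "h = min d1 (min d2 d3) / 3"
  have h: "h > 0" using d d3 by (simp add: h_def)
  have near: "dist (u + s *\<^sub>R axis a 1 + t *\<^sub>R axis b 1) u < min d1 (min d2 d3)"
    if "0 \<le> s" "s \<le> h" "0 \<le> t" "t \<le> h" for s t and a b :: 2
  proof -
    have "dist (u + s *\<^sub>R axis a 1 + t *\<^sub>R axis b 1) u = norm (s *\<^sub>R axis a 1 + t *\<^sub>R axis b (1::real) :: real^2)"
      by (simp add: dist_norm add_ac)
    also have "\<dots> \<le> s + t"
      using that norm_triangle_ineq[of "s *\<^sub>R axis a 1 :: real^2" "t *\<^sub>R axis b 1"] by simp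
    also have "\<dots> < min d1 (min d2 d3)"
      using that h unfolding h_def by linarith
    finally show ?thesis .
  qed
  have box: "u + s *\<^sub>R axis a 1 + t *\<^sub>R axis b 1 \<in> U"
    if "0 \<le> s" "s \<le> h" "0 \<le> t" "t \<le> h" for s t and a b :: 2
    using near[OF that] d3 by (auto simp: dist_commute subset_iff)
  obtain s t where st: "0 < s" "s < h" "0 < t" "t < h" and 1:
    "g (u + h *\<^sub>R axis i 1 + h *\<^sub>R axis j 1) - g (u + h *\<^sub>R axis i 1) - g (u + h *\<^sub>R axis j 1) + g u
      = h * h * pd j (pd i g) (u + s *\<^sub>R axis i 1 + t *\<^sub>R axis j 1)"
    using mixed_difference_eq[of U g i h u j] C h box by auto
  obtain s' t' where st': "0 < s'" "s' < h" "0 < t'" "t' < h" and 2: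
    "g (u + h *\<^sub>R axis j 1 + h *\<^sub>R axis i 1) - g (u + h *\<^sub>R axis j 1) - g (u + h *\<^sub>R axis i 1) + g u
      = h * h * pd i (pd j g) (u + s' *\<^sub>R axis j 1 + t' *\<^sub>R axis i 1)"
    using mixed_difference_eq[of U g j h u i] C h box by auto
  have "h * h * pd j (pd i g) (u + s *\<^sub>R axis i 1 + t *\<^sub>R axis j 1)
      = h * h * pd i (pd j g) (u + s' *\<^sub>R axis j 1 + t' *\<^sub>R axis i 1)"
    unfolding 1[symmetric] 2[symmetric] by (simp add: add_ac)
  then have "pd j (pd i g) (u + s *\<^sub>R axis i 1 + t *\<^sub>R axis j 1)
      = pd i (pd j g) (u + s' *\<^sub>R axis j 1 + t' *\<^sub>R axis i 1)"
    using h by simp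
  moreover have "dist (pd j (pd i g) (u + s *\<^sub>R axis i 1 + t *\<^sub>R axis j 1)) (pd j (pd i g) u) < e"
    using near[of s t i j] st by (intro d2) auto
  moreover have "dist (pd i (pd j g) (u + s' *\<^sub>R axis j 1 + t' *\<^sub>R axis i 1)) (pd i (pd j g) u) < e"
    using near[of s' t' j i] st' by (intro d1) auto
  ultimately have "\<bar>pd i (pd j g) u - pd j (pd i g) u\<bar> < 2 * e"
    by (auto simp: dist_real_def)
  then show False by (simp add: e_def)
qed

lemma Ck_on_2D:
  assumes "Ck_on 2 f U" "u \<in> U"
  shows "f differentiable (at u)" "pd i f differentiable (at u)"
  using assms by (auto simp: numeral_2_eq_2)

lemma pd_commute:
  fixes f :: "real^2 \<Rightarrow> 'b::euclidean_space"
  assumes U: "open U" "u \<in> U" and f: "Ck_on 2 f U"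
  shows "pd i (pd j f) u = pd j (pd i f) u"
proof (rule euclidean_eqI)
  fix b :: 'b
  have "Ck_on 2 (\<lambda>v. f v \<bullet> b) U"
    using U f by (intro Ck_on_bounded_bilinear[OF _ bounded_bilinear_inner] Ck_on_const)
  then have sym: "pd i (pd j (\<lambda>v. f v \<bullet> b)) u = pd j (pd i (\<lambda>v. f v \<bullet> b)) u"
    using pd_commute_real U by blast
  have pd1: "pd k (\<lambda>v. f v \<bullet> b) v = pd k f v \<bullet> b" if "v \<in> U" for k v
    by (rule pd_bounded_linear[OF bounded_linear_inner_left Ck_on_2D(1)[OF f that]])
  have "pd k (pd l (\<lambda>v. f v \<bullet> b)) u = pd k (pd l f) u \<bullet> b" for k l
    using pd_cong_open[OF U pd1]
      pd_bounded_linear[OF bounded_linear_inner_left Ck_on_2D(2)[OF f U(2)]] by simp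
  with sym show "pd i (pd j f) u \<bullet> b = pd j (pd i f) u \<bullet> b" by simp
qed

section \<open>Vector fields along a spherical immersion\<close>

text \<open>The identity \<open>D \<partial>\<^sub>l tr h = D G\<^sup>i\<^sup>j \<nabla>\<^sub>i h\<^sub>j\<^sub>l\<close>, where \<open>G\<close> is the inverse and \<open>D\<close> the determinant of the
  metric \<open>e\<close>. The trace enters as \<open>(e\<^sub>2\<^sub>2 h\<^sub>1\<^sub>1 - 2 e\<^sub>1\<^sub>2 h\<^sub>1\<^sub>2 + e\<^sub>1\<^sub>1 h\<^sub>2\<^sub>2) / D\<close>, so that the inverse metric is
  never differentiated; \<open>ed\<close> stands for \<open>\<partial>\<^sub>l e\<close>, \<open>hd a\<close> for \<open>\<partial>\<^sub>a h\<close>, \<open>p i j k\<close> for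
  \<open>\<langle>\<nu>\<^sub>i\<^sub>j, \<nu>\<^sub>k\<rangle>\<close>, and \<open>q i j k\<close> for \<open>\<langle>f\<^sub>i\<^sub>j, \<nu>\<^sub>k\<rangle>\<close>.\<close>

lemma trace_derivative_eq:
  fixes G e h :: "2 \<Rightarrow> 2 \<Rightarrow> real" and p q hd :: "2 \<Rightarrow> 2 \<Rightarrow> 2 \<Rightarrow> real" and l :: 2
  assumes e: "e 1 1 = D * G 2 2" "e 2 2 = D * G 1 1" "e 1 2 = - (D * G 1 2)"
    and G: "G 2 1 = G 1 2" "D * (G 1 1 * G 2 2 - G 1 2 * G 1 2) = 1"
    and h: "h 2 1 = h 1 2"
    and p: "\<And>k. p 2 1 k = p 1 2 k" and q: "\<And>k. q 2 1 k = q 1 2 k"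
    and hd: "\<And>a i j. hd a i j = q a i j + (\<Sum>m\<in>UNIV. \<Sum>k\<in>UNIV. h i m * G m k * p a j k)"
    and cod: "\<And>a. hd a 1 2 = hd a 2 1"
    and ed: "\<And>i j. ed i j = p l i j + p l j i"
  shows "ed 2 2 * h 1 1 + e 2 2 * hd l 1 1 - 2 * (ed 1 2 * h 1 2 + e 1 2 * hd l 1 2)
      + (ed 1 1 * h 2 2 + e 1 1 * hd l 2 2)
      - (\<Sum>i\<in>UNIV. \<Sum>j\<in>UNIV. G i j * h i j) * (ed 1 1 * e 2 2 + e 1 1 * ed 2 2 - 2 * (ed 1 2 * e 1 2))
    = D * (\<Sum>i\<in>UNIV. \<Sum>j\<in>UNIV. G i j *
          (q i j l - (\<Sum>k\<in>UNIV. (\<Sum>m\<in>UNIV. G k m * p i j m) * h k l)))"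
proof -
  \<comment> \<open>The derivative of the trace of \<open>h\<close>, with the inverse metric
    differentiated by \<partial>G = - G (\<partial>e) G.\<close>
  define tr where "tr = (\<Sum>i\<in>UNIV. \<Sum>j\<in>UNIV. G i j * hd l i j)
    - (\<Sum>i\<in>UNIV. \<Sum>j\<in>UNIV. \<Sum>a\<in>UNIV. \<Sum>b\<in>UNIV. G i a * G j b * ed a b * h i j)"
  have s: "ed 2 1 = ed 1 2" by (simp add: ed)
  \<comment> \<open>The quotient rule for the trace, multiplied by \<open>D\<close>; the last
    bracket on the left is the derivative of the determinant.\<close>
  have "ed 2 2 * h 1 1 + e 2 2 * hd l 1 1 - 2 * (ed 1 2 * h 1 2 + e 1 2 * hd l 1 2)
      + (ed 1 1 * h 2 2 + e 1 1 * hd l 2 2)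
      - (\<Sum>i\<in>UNIV. \<Sum>j\<in>UNIV. G i j * h i j) * (ed 1 1 * e 2 2 + e 1 1 * ed 2 2 - 2 * (ed 1 2 * e 1 2))
    = D * tr"
    unfolding tr_def sum_2 e G(1) h cod[of l, symmetric] s using G(2) by algebra
  also have "tr = (\<Sum>i\<in>UNIV. \<Sum>j\<in>UNIV. G i j *
          (q i j l - (\<Sum>k\<in>UNIV. (\<Sum>m\<in>UNIV. G k m * p i j m) * h k l)))"
  proof -
    \<comment> \<open>The two Codazzi equations, one for each direction of differentiation, written
      out in \<open>q\<close>, \<open>h\<close>, \<open>G\<close> and \<open>p\<close>.\<close>
    note cod' = cod[of 1, unfolded hd sum_2 G(1) h p q] cod[of 2, unfolded hd sum_2 G(1) h p q]
    consider "l = 1" | "l = 2" using exhaust_2 by blast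
    then show ?thesis
    proof cases
      case 1
      show ?thesis unfolding tr_def hd ed sum_2 1 G(1) h p q using cod' by algebra
    next
      case 2
      show ?thesis unfolding tr_def hd ed sum_2 2 G(1) h p q using cod' by algebra
    qed
  qed
  finally show ?thesis .
qed

section \<open>Linear algebra of frames and of two-by-two matrices\<close>

text \<open>Lagrange's formula for the triple product is used twice: it gives \<open>d\<close>
  \<times> N = 0 for N = \<open>cross3 a b\<close>, and then the expansion of N \<times>
  (\<open>d\<close> \<times> N) isolates \<open>d\<close>.\<close>

lemma cross3_normal_eq:
  fixes a b d :: "real^3"
  assumes "cross3 a b \<noteq> 0" "d \<bullet> a = 0" "d \<bullet> b = 0"
  shows "d = ((d \<bullet> cross3 a b) / (cross3 a b \<bullet> cross3 a b)) *\<^sub>R cross3 a b"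
proof -
  let ?N = "cross3 a b"
  have "cross3 d ?N = 0" by (simp add: Lagrange assms)
  then have "(?N \<bullet> ?N) *\<^sub>R d = (d \<bullet> ?N) *\<^sub>R ?N"
    using Lagrange[of ?N d ?N] by (simp add: inner_commute)
  then have "inverse (?N \<bullet> ?N) *\<^sub>R (?N \<bullet> ?N) *\<^sub>R d = inverse (?N \<bullet> ?N) *\<^sub>R (d \<bullet> ?N) *\<^sub>R ?N"
    by simp
  then show ?thesis using assms(1) by (simp add: divide_inverse mult.commute)
qed

text \<open>Both \<open>w - w'\<close> and \<open>n\<close> are multiples of
  \<open>cross3 a b\<close>, the latter a nonzero one; being orthogonal to \<open>n\<close>, the
  former vanishes.\<close>

lemma frame_eqI:
  fixes a b n w w' :: "real^3"
  assumes N: "cross3 a b \<noteq> 0" and n: "n \<noteq> 0" "n \<bullet> a = 0" "n \<bullet> b = 0"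
    and w: "w \<bullet> a = w' \<bullet> a" "w \<bullet> b = w' \<bullet> b" "w \<bullet> n = w' \<bullet> n"
  shows "w = w'"
proof -
  define d where "d = w - w'"
  have d: "d \<bullet> a = 0" "d \<bullet> b = 0" "d \<bullet> n = 0"
    using w by (simp_all add: d_def inner_diff_left)
  obtain s where s: "d = s *\<^sub>R cross3 a b" using cross3_normal_eq[OF N d(1,2)] by blast
  obtain t where t: "n = t *\<^sub>R cross3 a b" using cross3_normal_eq[OF N n(2,3)] by blast
  have "s * t * (cross3 a b \<bullet> cross3 a b) = 0" using d(3) by (auto simp: s t)
  moreover have "t \<noteq> 0" using n(1) t by auto
  ultimately have "s = 0" using N by auto
  then show ?thesis using s by (simp add: d_def)
qed

lemma matrix_inv_2:
  fixes A :: "real^2^2"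
  assumes D: "det A \<noteq> 0"
  shows "matrix_inv A $ 1 $ 1 = A $ 2 $ 2 / det A" "matrix_inv A $ 2 $ 2 = A $ 1 $ 1 / det A"
    "matrix_inv A $ 1 $ 2 = - A $ 1 $ 2 / det A" "matrix_inv A $ 2 $ 1 = - A $ 2 $ 1 / det A"
proof -
  \<comment> \<open>\<open>matrix_inv\<close> is a choice, so its defining property is available
    only once some inverse is known to exist.\<close>
  have "\<exists>B. A ** B = mat 1 \<and> B ** A = mat 1"
    using D invertible_det_nz[of A] by (simp add: invertible_def)
  then have "A ** matrix_inv A = mat 1"
    unfolding matrix_inv_def by (rule someI2_ex) simp
  then have *: "(A ** matrix_inv A) $ i $ j = (if i = j then 1 else 0)" for i j
    by (simp add: mat_def)
  have E: "A$1$1 * A$2$2 - A$1$2 * A$2$1 \<noteq> 0" using D by (simp add: det_2)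
  have "A$1$1 * matrix_inv A$1$1 + A$1$2 * matrix_inv A$2$1 = 1"
    "A$1$1 * matrix_inv A$1$2 + A$1$2 * matrix_inv A$2$2 = 0"
    "A$2$1 * matrix_inv A$1$1 + A$2$2 * matrix_inv A$2$1 = 0"
    "A$2$1 * matrix_inv A$1$2 + A$2$2 * matrix_inv A$2$2 = 1"
    using *[of 1 1] *[of 1 2] *[of 2 1] *[of 2 2] by (simp_all add: matrix_matrix_mult_def sum_2)
  then have "matrix_inv A $ 1 $ 1 * det A = A $ 2 $ 2" "matrix_inv A $ 2 $ 2 * det A = A $ 1 $ 1"
    "matrix_inv A $ 1 $ 2 * det A = - A $ 1 $ 2" "matrix_inv A $ 2 $ 1 * det A = - A $ 2 $ 1"
    unfolding det_2 by algebra+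
  then show "matrix_inv A $ 1 $ 1 = A $ 2 $ 2 / det A" "matrix_inv A $ 2 $ 2 = A $ 1 $ 1 / det A"
    "matrix_inv A $ 1 $ 2 = - A $ 1 $ 2 / det A" "matrix_inv A $ 2 $ 1 = - A $ 2 $ 1 / det A"
    by (simp_all only: nonzero_eq_divide_eq[OF D])
qed

text \<open>Gathering the components into one vector makes it possible to take inner products with a
  moving frame.\<close>

lemma beltrami2_vec_eq:
  assumes U: "open U" "u \<in> U" and f: "Ck_on 2 f U"
  shows "beltrami2_vec e f u = - (\<Sum>i\<in>UNIV. \<Sum>j\<in>UNIV. matrix_inv (e u) $ i $ j *\<^sub>R
    (pd i (pd j f) u - (\<Sum>k\<in>UNIV. christoffel e k i j u *\<^sub>R pd k f u)))"
proof -
  have 1: "pd k (\<lambda>v. f v $ a) v = pd k f v $ a" if "v \<in> U" for k v a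
    using Ck_on_2D(1)[OF f that] by (rule pd_vec_nth)
  have 2: "pd i (pd j (\<lambda>v. f v $ a)) u = pd i (pd j f) u $ a" for i j a
    using pd_cong_open[OF U 1] pd_vec_nth[OF Ck_on_2D(2)[OF f U(2)]] by simp
  show ?thesis
    by (simp add: vec_eq_iff beltrami2_vec_def beltrami2_def cov_deriv_def 1[OF U(2)] 2)
qed

section \<open>The third fundamental form and its Christoffel symbols\<close>

text \<open>Models the unit normal of a surface in one chart. The metric induced by
  \<open>\<nu>\<close> is III, and the immersion condition is what nonvanishing curvature
  provides.\<close>

locale spherical_immersion =
  fixes U :: "(real^2) set" and \<nu> :: "real^2 \<Rightarrow> real^3"
  assumes open_U: "open U"
    and C2: "Ck_on 2 \<nu> U"
    and unit: "\<And>v. v \<in> U \<Longrightarrow> \<nu> v \<bullet> \<nu> v = 1"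
    and immersion: "\<And>v. v \<in> U \<Longrightarrow> cross3 (pd 1 \<nu> v) (pd 2 \<nu> v) \<noteq> 0"
begin

abbreviation "e v i j \<equiv> pd i \<nu> v \<bullet> pd j \<nu> v"
text \<open>These are the Christoffel symbols of the first kind of III; see
  \<open>christoffel_contract\<close>.\<close>

abbreviation "p v i j k \<equiv> pd i (pd j \<nu>) v \<bullet> pd k \<nu> v"
abbreviation "G v i j \<equiv> matrix_inv (form3 \<nu> v) $ i $ j"
abbreviation "D v \<equiv> e v 1 1 * e v 2 2 - e v 1 2 * e v 1 2"

lemma nu_differentiable: "v \<in> U \<Longrightarrow> \<nu> differentiable (at v)"
  and pd_nu_differentiable: "v \<in> U \<Longrightarrow> pd i \<nu> differentiable (at v)"
  using Ck_on_2D[OF C2] by auto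

lemma e_21: "e v 2 1 = e v 1 2"
  by (simp add: inner_commute)

lemma det_form3: "det (form3 \<nu> v) = D v"
  by (simp add: det_2 form3_def e_21)

text \<open>By Lagrange's identity, \<open>D v\<close> is the squared length of the cross product of
  the two partial derivatives of \<open>\<nu>\<close>.\<close>

lemma D_nonzero: "v \<in> U \<Longrightarrow> D v \<noteq> 0"
  using immersion[of v] dot_cross[of "pd 1 \<nu> v" "pd 2 \<nu> v" "pd 1 \<nu> v" "pd 2 \<nu> v"]
  by (metis e_21 inner_eq_zero_iff)

lemma G_eq:
  assumes "v \<in> U"
  shows "G v 1 1 = e v 2 2 / D v" "G v 2 2 = e v 1 1 / D v"
    "G v 1 2 = - e v 1 2 / D v" "G v 2 1 = - e v 1 2 / D v"
  using matrix_inv_2[of "form3 \<nu> v"] D_nonzero[OF assms]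
  by (simp_all add: det_form3) (simp_all add: form3_def e_21)

lemma e_eq:
  assumes "v \<in> U"
  shows "e v 1 1 = D v * G v 2 2" "e v 2 2 = D v * G v 1 1" "e v 1 2 = - (D v * G v 1 2)"
    "G v 2 1 = G v 1 2"
  using D_nonzero[OF assms] by (simp_all add: G_eq[OF assms])

lemma D_mult_det_G:
  assumes "v \<in> U"
  shows "D v * (G v 1 1 * G v 2 2 - G v 1 2 * G v 1 2) = 1"
proof -
  have "D v * (D v * (G v 1 1 * G v 2 2 - G v 1 2 * G v 1 2)) = D v * 1"
    using e_eq[OF assms] by algebra
  then show ?thesis
    using D_nonzero[OF assms] mult_left_cancel by blast
qed

lemma G_mult_e:
  assumes "v \<in> U"
  shows "(\<Sum>j\<in>UNIV. G v i j * e v j k) = (if i = k then 1 else 0)"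
  using D_nonzero[OF assms] exhaust_2[of i] exhaust_2[of k]
  by (auto simp: sum_2 G_eq[OF assms] e_21 divide_simps)

text \<open>Differentiation of |\<nu>|^2 = 1.\<close>

lemma pd_nu_orthogonal:
  assumes "v \<in> U"
  shows "pd i \<nu> v \<bullet> \<nu> v = 0"
proof -
  have "pd i (\<lambda>v. \<nu> v \<bullet> \<nu> v) v = 0"
    using pd_cong_open[OF open_U assms, of "\<lambda>v. \<nu> v \<bullet> \<nu> v" "\<lambda>v. 1"] unit by simp
  then show ?thesis
    using pd_inner[OF nu_differentiable nu_differentiable, OF assms assms]
    by (simp add: inner_commute)
qed

lemma eqI:
  assumes "v \<in> U" "\<And>i. w \<bullet> pd i \<nu> v = w' \<bullet> pd i \<nu> v" "w \<bullet> \<nu> v = w' \<bullet> \<nu> v"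
  shows "w = w'"
proof (rule frame_eqI[OF immersion[OF assms(1)]])
  show "\<nu> v \<noteq> 0" using unit[OF assms(1)] by auto
qed (use assms pd_nu_orthogonal in \<open>auto simp: inner_commute\<close>)

text \<open>Contracting \<open>pd k \<nu> v\<close> with \<open>G v m k\<close> yields the basis of
  the tangent plane dual to the vectors \<open>pd m \<nu> v\<close>.\<close>

lemma tangent_expansion:
  assumes v: "v \<in> U" and a: "a \<bullet> \<nu> v = 0"
  shows "a = (\<Sum>m\<in>UNIV. \<Sum>k\<in>UNIV. ((a \<bullet> pd m \<nu> v) * G v m k) *\<^sub>R pd k \<nu> v)"
proof (rule eqI[OF v])
  fix i
  have "(\<Sum>m\<in>UNIV. \<Sum>k\<in>UNIV. ((a \<bullet> pd m \<nu> v) * G v m k) *\<^sub>R pd k \<nu> v) \<bullet> pd i \<nu> v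
    = (\<Sum>m\<in>UNIV. (a \<bullet> pd m \<nu> v) * (\<Sum>k\<in>UNIV. G v m k * e v k i))"
    by (simp add: inner_sum_left sum_distrib_left mult.assoc)
  then show "a \<bullet> pd i \<nu> v = (\<Sum>m\<in>UNIV. \<Sum>k\<in>UNIV. ((a \<bullet> pd m \<nu> v) * G v m k) *\<^sub>R pd k \<nu> v) \<bullet> pd i \<nu> v"
    by (simp add: G_mult_e[OF v] if_distrib cong: if_cong)
qed (simp add: inner_sum_left a pd_nu_orthogonal[OF v])

lemma pd_e:
  assumes v: "v \<in> U"
  shows "pd l (\<lambda>v. e v i j) v = p v l i j + p v l j i"
  using pd_inner[OF pd_nu_differentiable pd_nu_differentiable, OF v v]
  by (simp add: inner_commute)

lemma p_commute: "v \<in> U \<Longrightarrow> p v i j k = p v j i k"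
  using pd_commute[OF open_U _ C2] by simp

text \<open>Since second derivatives of \<open>\<nu>\<close> commute, four of the six terms in the
  Christoffel formula cancel and the other two coincide.\<close>

lemma christoffel_eq:
  assumes v: "v \<in> U"
  shows "christoffel (form3 \<nu>) k i j v = (\<Sum>l\<in>UNIV. G v k l * p v i j l)"
proof -
  have "christoffel (form3 \<nu>) k i j v = (\<Sum>l\<in>UNIV. G v k l *
      ((p v i j l + p v i l j) + (p v j i l + p v j l i) - (p v l i j + p v l j i))) / 2"
    by (simp add: christoffel_def pd_e[OF v] form3_def cong: if_cong)
  also have "\<dots> = (\<Sum>l\<in>UNIV. G v k l * (2 * p v i j l)) / 2"
    using p_commute[OF v] by (simp add: sum_2)
  finally show ?thesis by (simp add: sum_2)
qed

text \<open>Lowering the upper index with the metric. Hence the Christoffel terms cancel the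
  tangential part of \<open>pd i (pd j \<nu>)\<close>.\<close>

lemma christoffel_contract:
  assumes v: "v \<in> U"
  shows "(\<Sum>k\<in>UNIV. christoffel (form3 \<nu>) k i j v * e v k l) = p v i j l"
proof -
  have "(\<Sum>k\<in>UNIV. christoffel (form3 \<nu>) k i j v * e v k l)
      = (\<Sum>m\<in>UNIV. p v i j m * (\<Sum>k\<in>UNIV. G v m k * e v k l))"
    by (simp add: christoffel_eq[OF v] sum_2 G_eq[OF v] algebra_simps)
  then show ?thesis by (simp add: G_mult_e[OF v] if_distrib cong: if_cong)
qed

section \<open>Normal and tangential components of the Beltrami operator\<close>

text \<open>Differentiation of the orthogonality relation. It is applied both to
  \<open>\<nu>\<close> itself and to an eigenfunction with tangent derivatives.\<close>

lemma second_derivative_normal: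
  assumes v: "v \<in> U" and f: "\<And>v j. v \<in> U \<Longrightarrow> pd j f v \<bullet> \<nu> v = 0"
    and "pd j f differentiable (at v)"
  shows "pd i (pd j f) v \<bullet> \<nu> v = - (pd j f v \<bullet> pd i \<nu> v)"
proof -
  have "pd i (\<lambda>v. pd j f v \<bullet> \<nu> v) v = 0"
    using pd_cong_open[OF open_U v, of "\<lambda>v. pd j f v \<bullet> \<nu> v" "\<lambda>v. 0"] f by simp
  then show ?thesis
    using pd_inner[OF assms(3) nu_differentiable[OF v], of i] by simp
qed

text \<open>The covariant Hessian of \<open>\<nu>\<close> is - \<open>e\<close> times
  \<open>\<nu>\<close>: its tangential part is cancelled by the Christoffel terms. The factor 2 is
  the trace of the metric with respect to itself.\<close>

lemma beltrami2_nu: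
  assumes v: "v \<in> U"
  shows "beltrami2_vec (form3 \<nu>) \<nu> v = 2 *\<^sub>R \<nu> v"
proof (rule eqI[OF v])
  fix l
  show "beltrami2_vec (form3 \<nu>) \<nu> v \<bullet> pd l \<nu> v = (2 *\<^sub>R \<nu> v) \<bullet> pd l \<nu> v"
    using pd_nu_orthogonal[OF v, of l]
    by (simp add: beltrami2_vec_eq[OF open_U v C2] inner_sum_left inner_diff_left
        christoffel_contract[OF v] inner_commute[of "\<nu> v"])
next
  have "beltrami2_vec (form3 \<nu>) \<nu> v \<bullet> \<nu> v = (\<Sum>i\<in>UNIV. \<Sum>j\<in>UNIV. G v i j * e v j i)"
    using second_derivative_normal[OF v pd_nu_orthogonal pd_nu_differentiable[OF v]]
    by (simp add: beltrami2_vec_eq[OF open_U v C2] inner_sum_left inner_diff_left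
        pd_nu_orthogonal[OF v] sum_negf)
  then show "beltrami2_vec (form3 \<nu>) \<nu> v \<bullet> \<nu> v = (2 *\<^sub>R \<nu> v) \<bullet> \<nu> v"
    by (simp add: G_mult_e[OF v] unit[OF v])
qed

lemma eigenfunction_normal:
  assumes f: "Ck_on 2 f U"
    and tangent: "\<And>v j. v \<in> U \<Longrightarrow> pd j f v \<bullet> \<nu> v = 0"
    and eigen: "\<And>v. v \<in> U \<Longrightarrow> beltrami2_vec (form3 \<nu>) f v = c *\<^sub>R f v"
    and c: "c \<noteq> 0" and v: "v \<in> U"
  shows "f v \<bullet> pd l \<nu> v = 0"
proof -
  define h where "h v i j = pd i f v \<bullet> pd j \<nu> v" for v i j
  define q where "q i j k = pd i (pd j f) v \<bullet> pd k \<nu> v" for i j k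
  note f_diff = Ck_on_2D[OF f]
  \<comment> \<open>Up to sign, both sides are the normal component of the same mixed derivative of
    \<open>f\<close>.\<close>
  have h_sym: "h v i j = h v j i" if "v \<in> U" for v i j
    using second_derivative_normal[OF that tangent f_diff(2)[OF that]]
      pd_commute[OF open_U that f] unfolding h_def by (metis neg_equal_iff_equal)
  \<comment> \<open>The Christoffel terms are multiples of the tangent vectors
    \<open>pd k f v\<close> and drop out, leaving the trace of \<open>h\<close>.\<close>
  have normal: "c * (f v \<bullet> \<nu> v) = (\<Sum>i\<in>UNIV. \<Sum>j\<in>UNIV. G v i j * h v i j)" if "v \<in> U" for v
  proof -
    have "c * (f v \<bullet> \<nu> v) = beltrami2_vec (form3 \<nu>) f v \<bullet> \<nu> v" by (simp add: eigen[OF that])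
    also have "\<dots> = (\<Sum>i\<in>UNIV. \<Sum>j\<in>UNIV. G v i j * h v j i)"
      using second_derivative_normal[OF that tangent f_diff(2)[OF that]]
      by (simp add: beltrami2_vec_eq[OF open_U that f] inner_sum_left inner_diff_left
          tangent[OF that] sum_negf h_def)
    finally show ?thesis by (simp add: h_sym[OF that])
  qed
  have tangential: "c * (f v \<bullet> pd l \<nu> v) = - (\<Sum>i\<in>UNIV. \<Sum>j\<in>UNIV. G v i j *
      (q i j l - (\<Sum>k\<in>UNIV. (\<Sum>m\<in>UNIV. G v k m * p v i j m) * h v k l)))"
  proof -
    have "c * (f v \<bullet> pd l \<nu> v) = beltrami2_vec (form3 \<nu>) f v \<bullet> pd l \<nu> v" by (simp add: eigen[OF v])
    then show ?thesis
      by (simp add: beltrami2_vec_eq[OF open_U v f] inner_sum_left inner_diff_left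
          h_def q_def christoffel_eq[OF v])
  qed
  \<comment> \<open>In the product rule, the tangent vector \<open>pd i f v\<close> is expanded in
    the \<open>pd k \<nu> v\<close>, so that only the products \<open>p\<close> occur.\<close>
  have pd_h: "pd a (\<lambda>v. h v i j) v
      = q a i j + (\<Sum>m\<in>UNIV. \<Sum>k\<in>UNIV. h v i m * G v m k * p v a j k)" for a i j
  proof -
    have "pd a (\<lambda>v. h v i j) v = q a i j + pd i f v \<bullet> pd a (pd j \<nu>) v"
      using pd_inner[OF f_diff(2) pd_nu_differentiable, OF v v]
      by (simp add: h_def q_def add.commute)
    also have "pd i f v \<bullet> pd a (pd j \<nu>) v
        = (\<Sum>m\<in>UNIV. \<Sum>k\<in>UNIV. ((pd i f v \<bullet> pd m \<nu> v) * G v m k) *\<^sub>R pd k \<nu> v) \<bullet> pd a (pd j \<nu>) v"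
      using tangent_expansion[OF v tangent[OF v]] by simp
    finally show ?thesis by (simp add: inner_sum_left h_def inner_commute[of "pd a (pd j \<nu>) v"])
  qed
  \<comment> \<open>The symmetry of \<open>h\<close>, differentiated. Together with
    \<open>pd_h\<close> and the symmetry of \<open>q\<close> in its first two indices it makes the
    covariant derivative of \<open>h\<close> totally symmetric, which is the Codazzi
    equation.\<close>
  have codazzi: "pd a (\<lambda>v. h v 1 2) v = pd a (\<lambda>v. h v 2 1) v" for a
    by (rule pd_cong_open[OF open_U v h_sym])
  have e_diff: "(\<lambda>v. e v i j) differentiable (at v)" for i j
    using pd_nu_differentiable[OF v] by (intro bounded_bilinear_differentiable[OF bounded_bilinear_inner])
  have h_diff: "(\<lambda>v. h v i j) differentiable (at v)" for i j
    unfolding h_def using pd_nu_differentiable[OF v] f_diff(2)[OF v]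
    by (intro bounded_bilinear_differentiable[OF bounded_bilinear_inner])
  have fnu_diff: "(\<lambda>v. f v \<bullet> \<nu> v) differentiable (at v)"
    using nu_differentiable[OF v] f_diff(1)[OF v]
    by (intro bounded_bilinear_differentiable[OF bounded_bilinear_inner])
  have pd_fnu: "pd l (\<lambda>v. f v \<bullet> \<nu> v) v = f v \<bullet> pd l \<nu> v"
    using pd_inner[OF f_diff(1) nu_differentiable, OF v v] tangent[OF v] by simp
  \<comment> \<open>Multiplied by \<open>D v\<close>, the trace is a polynomial in \<open>e\<close>
    and \<open>h\<close>, whose derivatives are known.\<close>
  have trace: "c * (f v \<bullet> \<nu> v) * D v = e v 2 2 * h v 1 1 - 2 * (e v 1 2 * h v 1 2) + e v 1 1 * h v 2 2"
    if "v \<in> U" for v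
    unfolding normal[OF that] sum_2 using e_eq[OF that] h_sym[OF that, of 2 1] by algebra
  have pd_D: "pd l D v = pd l (\<lambda>v. e v 1 1) v * e v 2 2 + e v 1 1 * pd l (\<lambda>v. e v 2 2) v
      - 2 * (pd l (\<lambda>v. e v 1 2) v * e v 1 2)"
    by (simp add: pd_mult pd_diff e_diff differentiable_mult)
  have D_diff: "D differentiable (at v)"
    by (simp add: e_diff differentiable_mult differentiable_diff)
  have "pd l (\<lambda>v. c * (f v \<bullet> \<nu> v) * D v) v
      = pd l (\<lambda>v. e v 2 2 * h v 1 1 - 2 * (e v 1 2 * h v 1 2) + e v 1 1 * h v 2 2) v"
    by (rule pd_cong_open[OF open_U v trace])
  also have "pd l (\<lambda>v. c * (f v \<bullet> \<nu> v) * D v) v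
      = c * (f v \<bullet> \<nu> v) * pd l D v + c * (f v \<bullet> pd l \<nu> v) * D v"
    using pd_mult[OF _ D_diff, of "\<lambda>v. c * (f v \<bullet> \<nu> v)" l]
    by (simp add: pd_mult[OF differentiable_const fnu_diff] fnu_diff pd_fnu differentiable_mult)
  also have "pd l (\<lambda>v. e v 2 2 * h v 1 1 - 2 * (e v 1 2 * h v 1 2) + e v 1 1 * h v 2 2) v
      = pd l (\<lambda>v. e v 2 2) v * h v 1 1 + e v 2 2 * pd l (\<lambda>v. h v 1 1) v
      - 2 * (pd l (\<lambda>v. e v 1 2) v * h v 1 2 + e v 1 2 * pd l (\<lambda>v. h v 1 2) v)
      + (pd l (\<lambda>v. e v 1 1) v * h v 2 2 + e v 1 1 * pd l (\<lambda>v. h v 2 2) v)"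
    by (simp add: pd_mult pd_add pd_diff e_diff h_diff differentiable_mult differentiable_diff)
  finally have "c * (f v \<bullet> pd l \<nu> v) * D v
      = pd l (\<lambda>v. e v 2 2) v * h v 1 1 + e v 2 2 * pd l (\<lambda>v. h v 1 1) v
      - 2 * (pd l (\<lambda>v. e v 1 2) v * h v 1 2 + e v 1 2 * pd l (\<lambda>v. h v 1 2) v)
      + (pd l (\<lambda>v. e v 1 1) v * h v 2 2 + e v 1 1 * pd l (\<lambda>v. h v 2 2) v)
      - c * (f v \<bullet> \<nu> v) * (pd l (\<lambda>v. e v 1 1) v * e v 2 2 + e v 1 1 * pd l (\<lambda>v. e v 2 2) v
        - 2 * (pd l (\<lambda>v. e v 1 2) v * e v 1 2))"
    unfolding pd_D by linarith
  also have "\<dots> = D v * (\<Sum>i\<in>UNIV. \<Sum>j\<in>UNIV. G v i j *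
      (q i j l - (\<Sum>k\<in>UNIV. (\<Sum>m\<in>UNIV. G v k m * p v i j m) * h v k l)))"
    unfolding normal[OF v]
  proof (rule trace_derivative_eq[where G = "G v" and e = "e v" and h = "h v" and p = "p v" and q = q and D = "D v"])
    show "q 2 1 k = q 1 2 k" for k
      using pd_commute[OF open_U v f] by (simp add: q_def)
  qed (fact e_eq[OF v] D_mult_det_G[OF v] h_sym[OF v] p_commute[OF v] pd_h codazzi pd_e[OF v])+
  \<comment> \<open>The divergence of \<open>h\<close> is minus the tangential component of the
    eigenvalue equation, so the quantity equals its own negative.\<close>
  also have "\<dots> = - (c * (f v \<bullet> pd l \<nu> v) * D v)"
    using tangential by simp
  finally show ?thesis using c D_nonzero[OF v] by simp
qed

text \<open>By \<open>eigenfunction_normal\<close>, \<open>f\<close> is a multiple of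
  \<open>\<nu>\<close>, while its derivatives are tangent. The conclusion says that |f|^2 has
  vanishing derivative.\<close>

lemma eigenfunction_orthogonal:
  assumes f: "Ck_on 2 f U"
    and tangent: "\<And>v j. v \<in> U \<Longrightarrow> pd j f v \<bullet> \<nu> v = 0"
    and eigen: "\<And>v. v \<in> U \<Longrightarrow> beltrami2_vec (form3 \<nu>) f v = c *\<^sub>R f v"
    and c: "c \<noteq> 0" and v: "v \<in> U"
  shows "f v \<bullet> pd j f v = 0"
proof -
  have "f v = (f v \<bullet> \<nu> v) *\<^sub>R \<nu> v"
    using eigenfunction_normal[OF assms] pd_nu_orthogonal[OF v]
    by (intro eqI[OF v]) (auto simp: unit[OF v] inner_commute)
  then show ?thesis
    using tangent[OF v, of j] by (metis inner_commute inner_scaleR_left mult_zero_right)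
qed

end

section \<open>Locality and homogeneity of the Beltrami operator\<close>

lemma beltrami2_vec_cong:
  assumes "open U" "u \<in> U" "\<And>v. v \<in> U \<Longrightarrow> f v = g v"
  shows "beltrami2_vec e f u = beltrami2_vec e g u"
proof -
  have 1: "pd k (\<lambda>v. f v $ a) v = pd k (\<lambda>v. g v $ a) v" if "v \<in> U" for k v a
    using assms that by (intro pd_cong_open) auto
  have "pd i (pd j (\<lambda>v. f v $ a)) u = pd i (pd j (\<lambda>v. g v $ a)) u" for i j a
    using assms 1 by (intro pd_cong_open) auto
  then show ?thesis
    by (simp add: beltrami2_vec_def beltrami2_def cov_deriv_def 1[OF assms(2)])
qed

lemma beltrami2_vec_scaleR:
  assumes U: "open U" "u \<in> U" and f: "Ck_on 2 f U"
  shows "beltrami2_vec e (\<lambda>v. c *\<^sub>R f v) u = c *\<^sub>R beltrami2_vec e f u"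
proof -
  have 1: "pd k (\<lambda>v. c *\<^sub>R f v) v = c *\<^sub>R pd k f v" if "v \<in> U" for k v
    using Ck_on_2D(1)[OF f that] by (rule pd_scaleR_right)
  have 2: "pd i (pd j (\<lambda>v. c *\<^sub>R f v)) u = c *\<^sub>R pd i (pd j f) u" for i j
    using pd_cong_open[OF U 1] pd_scaleR_right[OF Ck_on_2D(2)[OF f U(2)]] by simp
  have "Ck_on 2 (\<lambda>v. c *\<^sub>R f v) U"
    using U f by (intro Ck_on_bounded_bilinear[OF _ bounded_bilinear_scaleR] Ck_on_const)
  from beltrami2_vec_eq[OF U this] show ?thesis
    by (simp add: beltrami2_vec_eq[OF U f] 1[OF U(2)] 2 scaleR_sum_right scaleR_diff_right
        mult_ac)
qed

section \<open>Charts of a surface\<close>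

text \<open>The sign of the inner product of \<open>a\<close> and \<open>b\<close> tells
  \<open>b\<close> from \<open>- b\<close>, and by continuity it persists near
  \<open>u\<close>.\<close>

lemma sign_locally_constant:
  fixes a b :: "'a::topological_space \<Rightarrow> 'b::real_inner"
  assumes U: "open U" "u \<in> U"
    and cont: "continuous_on U a" "continuous_on U b"
    and ab: "\<And>v. v \<in> U \<Longrightarrow> b v \<noteq> 0 \<and> (a v = b v \<or> a v = - b v)"
  obtains V s where "open V" "u \<in> V" "V \<subseteq> U" "s = 1 \<or> s = - 1" "\<And>v. v \<in> V \<Longrightarrow> a v = s *\<^sub>R b v"
proof -
  obtain s :: real where s: "s = 1 \<or> s = - 1" "a u = s *\<^sub>R b u"
    using ab[OF U(2)] by (metis scaleR_minus1_left scaleR_one)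
  define V where "V = {v \<in> U. 0 < s * (a v \<bullet> b v)}"
  have "continuous_on U (\<lambda>v. s * (a v \<bullet> b v))"
    using cont by (intro continuous_intros)
  moreover have "V = (\<lambda>v. s * (a v \<bullet> b v)) -` {0<..} \<inter> U"
    by (auto simp: V_def)
  ultimately have "open V"
    using U(1) continuous_on_open_vimage by (metis open_greaterThan)
  moreover have "u \<in> V"
    using s ab[OF U(2)] U(2) by (auto simp: V_def)
  moreover have "a v = s *\<^sub>R b v" if "v \<in> V" for v
  proof -
    have "\<not> b v \<bullet> b v < 0" by (simp add: not_less)
    then show ?thesis using that s(1) ab[of v] by (auto simp: V_def simp del: not_less)
  qed
  ultimately show thesis
    using that s(1) V_def by blast
qed

text \<open>The level set of \<open>g\<close> through \<open>p\<close> and its complement are both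
  open.\<close>

lemma connected_space_locally_constant:
  assumes "connected_space M"
    and loc: "\<And>p. p \<in> topspace M \<Longrightarrow> \<exists>W. openin M W \<and> p \<in> W \<and> (\<forall>q\<in>W. g q = g p)"
    and pq: "p \<in> topspace M" "q \<in> topspace M"
  shows "g q = g p"
proof (rule ccontr)
  assume "g q \<noteq> g p"
  have op: "openin M {r \<in> topspace M. P (g r)}" for P
    using loc by (subst openin_subopen) (smt (verit) mem_Collect_eq openin_subset subset_iff)
  show False
    using connected_spaceD[OF assms(1) op[of "\<lambda>a. a = g p"] op[of "\<lambda>a. a \<noteq> g p"]] pq \<open>g q \<noteq> g p\<close>
    by blast
qed

lemma has_derivative_zero_if_pd_zero:
  assumes "f differentiable (at u)" "\<And>i. pd i f u = 0"
  shows "(f has_derivative (\<lambda>_. 0)) (at u)"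
proof -
  have "linear (frechet_derivative f (at u))"
    using assms(1) by (rule linear_frechet_derivative)
  then have "frechet_derivative f (at u) h = 0" for h
    using linear_sum[of "frechet_derivative f (at u)" "\<lambda>i. h $ i *\<^sub>R axis i 1" UNIV]
      basis_expansion[of h] assms(2)
    by (simp add: linear_cmul pd_def scalar_mult_eq_scaleR)
  then show ?thesis
    using has_derivative_frechet[OF assms(1)] by (metis (no_types, lifting) ext)
qed

section \<open>Regularity of the Gauss map in a chart\<close>

context
  fixes M :: "'a topology" and x n :: "'a \<Rightarrow> real^3" and U :: "(real^2) set" and \<phi> :: "real^2 \<Rightarrow> 'a"
  assumes chart: "local_param M x U \<phi>"
begin

lemma open_chart: "open U"
  using chart by (simp add: local_param_def)

lemma chart_in_topspace: "u \<in> U \<Longrightarrow> \<phi> u \<in> topspace M"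
  using chart openin_subset unfolding local_param_def by blast

lemma openin_chart_image:
  assumes "open V" "V \<subseteq> U"
  shows "openin M (\<phi> ` V)"
proof -
  have "openin (subtopology M (\<phi> ` U)) (\<phi> ` V)"
    using chart assms homeomorphic_imp_open_map unfolding local_param_def open_map_def
    by (metis open_subset)
  then show ?thesis
    using chart openin_trans_full unfolding local_param_def by blast
qed

lemma C2_chart: "Ck_on 2 (x \<circ> \<phi>) U"
  and C2_pd_chart: "Ck_on 2 (pd i (x \<circ> \<phi>)) U"
  using chart Ck_on_SucD[of 2 "x \<circ> \<phi>" U] Ck_on.simps(2)[of 2 "x \<circ> \<phi>" U]
  by (auto simp: local_param_def)

lemma chart_cross_nonzero: "u \<in> U \<Longrightarrow> cross3 (pd 1 (x \<circ> \<phi>) u) (pd 2 (x \<circ> \<phi>) u) \<noteq> 0"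
  using chart by (simp add: local_param_def)

context
  assumes gauss: "gauss_map M x n"
begin

lemma chart_normal:
  assumes "u \<in> U"
  shows "(n \<circ> \<phi>) u \<bullet> (n \<circ> \<phi>) u = 1" "pd i (x \<circ> \<phi>) u \<bullet> (n \<circ> \<phi>) u = 0"
proof -
  have "n (\<phi> u) \<in> sphere 0 1"
    using gauss chart_in_topspace[OF assms]
    by (auto simp: gauss_map_def continuous_map_def Pi_iff)
  then show "(n \<circ> \<phi>) u \<bullet> (n \<circ> \<phi>) u = 1" by (simp add: dot_square_norm)
  show "pd i (x \<circ> \<phi>) u \<bullet> (n \<circ> \<phi>) u = 0"
    using gauss chart assms by (auto simp: gauss_map_def inner_commute)
qed

lemma continuous_chart_normal: "continuous_on U (n \<circ> \<phi>)"
proof -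
  have "continuous_map (top_of_set U) (subtopology M (\<phi> ` U)) \<phi>"
    using chart homeomorphic_imp_continuous_map unfolding local_param_def by blast
  then have "continuous_map (top_of_set U) M \<phi>"
    using continuous_map_in_subtopology by blast
  then have "continuous_map (top_of_set U) (top_of_set (sphere 0 1)) (n \<circ> \<phi>)"
    using gauss continuous_map_compose unfolding gauss_map_def by blast
  then show ?thesis by (simp add: continuous_map_in_subtopology)
qed

text \<open>A vector normal to the tangent plane is a multiple of the unit normal, and its length
  fixes the factor up to sign. It is used with \<open>r\<close> = 1 for the normalized cross product
  and with \<open>r\<close> the radius of a sphere.\<close>

lemma chart_normal_collinear:
  assumes u: "u \<in> U" and w: "\<And>i. w \<bullet> pd i (x \<circ> \<phi>) u = 0" and norm: "w \<bullet> w = r\<^sup>2"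
  shows "w = r *\<^sub>R (n \<circ> \<phi>) u \<or> w = - (r *\<^sub>R (n \<circ> \<phi>) u)"
proof -
  define t where "t = w \<bullet> (n \<circ> \<phi>) u"
  have "w = t *\<^sub>R (n \<circ> \<phi>) u"
    using u w chart_normal[OF u]
    by (intro frame_eqI[OF chart_cross_nonzero[OF u], of "(n \<circ> \<phi>) u"]) (auto simp: t_def inner_commute)
  moreover from this have "t\<^sup>2 = r\<^sup>2"
    using norm chart_normal(1)[OF u] by (metis inner_scaleR_left inner_scaleR_right mult.right_neutral power2_eq_square)
  ultimately show ?thesis by (auto simp: power2_eq_iff)
qed

text \<open>\<open>gauss_map\<close> demands only continuity and orthogonality. Near each point the
  map agrees, up to a constant sign, with the normalized cross product of the partial derivatives,
  which is C^2 because the position vector is C^3.\<close>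

lemma C2_chart_normal: "Ck_on 2 (n \<circ> \<phi>) U"
proof (rule Ck_on_locally)
  fix u assume u: "u \<in> U"
  define N where "N v = cross3 (pd 1 (x \<circ> \<phi>) v) (pd 2 (x \<circ> \<phi>) v)" for v
  \<comment> \<open>This is N / |N|, written as a power so that \<open>Ck_on_powr\<close>
    applies.\<close>
  define z where "z v = (N v \<bullet> N v) powr (- 1 / 2) *\<^sub>R N v" for v
  have pos: "N v \<bullet> N v > 0" if "v \<in> U" for v
    using chart_cross_nonzero[OF that] by (simp add: N_def)
  have N: "Ck_on 2 N U"
    unfolding N_def by (rule Ck_on_bounded_bilinear[OF open_chart bounded_bilinear_cross3 C2_pd_chart C2_pd_chart])
  have z: "Ck_on 2 z U"
    unfolding z_def
    by (intro Ck_on_bounded_bilinear[OF open_chart bounded_bilinear_scaleR] Ck_on_powr open_chart pos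
        Ck_on_bounded_bilinear[OF open_chart bounded_bilinear_inner] N)
  have z_unit: "z v \<bullet> z v = 1" if "v \<in> U" for v
  proof -
    have "z v \<bullet> z v = (N v \<bullet> N v) powr (- 1 / 2) * (N v \<bullet> N v) powr (- 1 / 2) * (N v \<bullet> N v)"
      by (simp add: z_def)
    also have "\<dots> = (N v \<bullet> N v) powr (- 1 / 2 + - 1 / 2) * (N v \<bullet> N v)"
      by (simp only: powr_add)
    finally show ?thesis using pos[OF that] by (simp add: powr_minus)
  qed
  have "z v \<bullet> pd i (x \<circ> \<phi>) v = 0" for i v
    using exhaust_2[of i] by (auto simp: z_def N_def dot_cross_self)
  then have "z v = (n \<circ> \<phi>) v \<or> z v = - (n \<circ> \<phi>) v" if "v \<in> U" for v
    using chart_normal_collinear[OF that, of "z v" 1] z_unit[OF that] by simp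
  then have "z v \<noteq> 0 \<and> ((n \<circ> \<phi>) v = z v \<or> (n \<circ> \<phi>) v = - z v)" if "v \<in> U" for v
    using z_unit[OF that] that by (metis inner_zero_left minus_minus zero_neq_one)
  moreover have "continuous_on U z"
    using z by (rule Ck_on_imp_continuous_on)
  ultimately obtain V s where V: "open V" "u \<in> V" "V \<subseteq> U" "\<And>v. v \<in> V \<Longrightarrow> (n \<circ> \<phi>) v = s *\<^sub>R z v"
    using sign_locally_constant[OF open_chart u continuous_chart_normal] by metis
  have "Ck_on 2 (\<lambda>v. s *\<^sub>R z v) V"
    using V Ck_on_subset[OF z]
    by (intro Ck_on_bounded_bilinear[OF _ bounded_bilinear_scaleR] Ck_on_const)
  then show "\<exists>V. open V \<and> u \<in> V \<and> Ck_on 2 (n \<circ> \<phi>) V"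
    using V(1,2) Ck_on_cong[OF V(1), of "n \<circ> \<phi>" "\<lambda>v. s *\<^sub>R z v"] V(4) by metis
qed

text \<open>By the Weingarten relation and the Binet-Cauchy identity, the determinant of the second
  fundamental form is the inner product of the cross products belonging to \<open>x\<close> and to
  \<open>n\<close>; nonzero curvature thus forces the latter to be nonzero.\<close>

lemma chart_spherical_immersion:
  assumes K: "no_parabolic_points M x n"
  shows "spherical_immersion U (n \<circ> \<phi>)"
proof
  fix v assume v: "v \<in> U"
  let ?y = "x \<circ> \<phi>" and ?\<nu> = "n \<circ> \<phi>"
  have "pd i (pd j ?y) v \<bullet> ?\<nu> v = - (pd j ?y v \<bullet> pd i ?\<nu> v)" for i j
  proof -
    have "pd i (\<lambda>v. pd j ?y v \<bullet> ?\<nu> v) v = 0"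
      using pd_cong_open[OF open_chart v, of "\<lambda>v. pd j ?y v \<bullet> ?\<nu> v" "\<lambda>v. 0"] chart_normal(2) by simp
    then show ?thesis
      using pd_inner[OF Ck_on_2D(2)[OF C2_chart v] Ck_on_2D(1)[OF C2_chart_normal v], of i j] by simp
  qed
  then have "det (form2 ?y ?\<nu> v) = cross3 (pd 1 ?y v) (pd 2 ?y v) \<bullet> cross3 (pd 1 ?\<nu> v) (pd 2 ?\<nu> v)"
    by (simp add: det_2 form2_def dot_cross mult.commute)
  moreover have "det (form2 ?y ?\<nu> v) \<noteq> 0"
    using K chart v by (auto simp: no_parabolic_points_def gauss_curvature_def)
  ultimately show "cross3 (pd 1 ?\<nu> v) (pd 2 ?\<nu> v) \<noteq> 0" by auto
qed (use open_chart C2_chart_normal chart_normal in auto)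

end

lemma Ck_on_2_diff_const: "Ck_on 2 (\<lambda>v. (x \<circ> \<phi>) v - c) U"
  using Ck_on_add[OF open_chart C2_chart Ck_on_const[OF open_chart, of 2 "- c"]] by simp

lemma pd_chart_diff_const: "u \<in> U \<Longrightarrow> pd i (\<lambda>v. (x \<circ> \<phi>) v - c) u = pd i (x \<circ> \<phi>) u"
  using pd_diff[OF Ck_on_2D(1)[OF C2_chart] differentiable_const] by simp

text \<open>A constant position vector would have vanishing partial derivatives, against regularity.
  This yields the nonconstancy clause of \<open>III_decomposition\<close> and the positivity of the
  radius.\<close>

lemma not_constant_on_chart:
  assumes "u \<in> U"
  shows "\<not> (\<lambda>p. x p - c) constant_on topspace M"
proof
  assume "(\<lambda>p. x p - c) constant_on topspace M"
  then obtain d where "\<And>v. v \<in> U \<Longrightarrow> (x \<circ> \<phi>) v = d"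
    using chart_in_topspace unfolding constant_on_def by (metis comp_apply diff_add_cancel)
  then have "pd i (x \<circ> \<phi>) u = 0" for i
    using pd_cong_open[OF open_chart assms, of "x \<circ> \<phi>" "\<lambda>v. d"] by simp
  then show False using chart_cross_nonzero[OF assms] by simp
qed

end

section \<open>Surfaces of III-type 1\<close>

lemma III_type_1_imp_part_of_sphere:
  fixes M :: "'a topology" and x n :: "'a \<Rightarrow> real^3"
  assumes surf: "surface M x" and conn: "connected_space M"
    and gauss: "gauss_map M x n" and K: "no_parabolic_points M x n"
    and type: "III_type M x n 1"
  shows "part_of_sphere M x"
proof -
  \<comment> \<open>The sum over \<open>i < 1\<close> is the single term \<open>f 0\<close>, and the
    null case is excluded by \<open>III_type\<close>.\<close>
  obtain c f l where x: "\<And>p. p \<in> topspace M \<Longrightarrow> x p = c + f p"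
    and f: "III_eigen M x n l f" and l: "l \<noteq> 0"
    using type by (auto simp: III_type_def III_decomposition_def)
  define g where "g p = (x p - c) \<bullet> (x p - c)" for p
  have loc: "\<exists>W. openin M W \<and> p \<in> W \<and> (\<forall>q\<in>W. g q = g p)" if p: "p \<in> topspace M" for p
  proof -
    obtain U \<phi> u where chart: "local_param M x U \<phi>" and u: "u \<in> U" "p = \<phi> u"
      using surf p unfolding surface_def by blast
    let ?f = "\<lambda>v. (x \<circ> \<phi>) v - c"
    note U = open_chart[OF chart]
    have f_eq: "?f v = (f \<circ> \<phi>) v" if "v \<in> U" for v
      using x chart_in_topspace[OF chart that] by simp
    interpret spherical_immersion U "n \<circ> \<phi>"
      by (rule chart_spherical_immersion[OF chart gauss K])
    have orth: "?f v \<bullet> pd j ?f v = 0" if "v \<in> U" for v j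
    proof (rule eigenfunction_orthogonal[OF Ck_on_2_diff_const[OF chart] _ _ l that])
      show "pd j ?f v \<bullet> (n \<circ> \<phi>) v = 0" if "v \<in> U" for v j
        using pd_chart_diff_const[OF chart that] chart_normal[OF chart gauss that] by simp
      show "beltrami2_vec (form3 (n \<circ> \<phi>)) ?f v = l *\<^sub>R ?f v" if "v \<in> U" for v
      proof -
        \<comment> \<open>The eigenvalue equation is known for \<open>f\<close>, which is only known
          to equal \<open>x - c\<close> on the surface; on the open chart domain this
          suffices.\<close>
        have "beltrami2_vec (form3 (n \<circ> \<phi>)) ?f v = beltrami2_vec (form3 (n \<circ> \<phi>)) (f \<circ> \<phi>) v"
          by (rule beltrami2_vec_cong[OF U that f_eq])
        also have "\<dots> = l *\<^sub>R (f \<circ> \<phi>) v"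
          using f chart that by (simp add: III_eigen_def)
        finally show ?thesis by (simp only: f_eq[OF that])
      qed
    qed
    have deriv: "((\<lambda>v. ?f v \<bullet> ?f v) has_derivative (\<lambda>_. 0)) (at v)" if "v \<in> U" for v
    proof (rule has_derivative_zero_if_pd_zero)
      have d: "?f differentiable (at v)"
        using Ck_on_2D(1)[OF Ck_on_2_diff_const[OF chart] that] .
      then show "(\<lambda>v. ?f v \<bullet> ?f v) differentiable (at v)"
        by (intro bounded_bilinear_differentiable[OF bounded_bilinear_inner])
      show "pd i (\<lambda>v. ?f v \<bullet> ?f v) v = 0" for i
        using pd_inner[OF d d, of i] orth[OF that, of i] by (simp add: inner_commute)
    qed
    \<comment> \<open>\<open>U\<close> may be disconnected; a vanishing derivative gives constancy
      on a convex ball.\<close>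
    obtain r where r: "r > 0" "ball u r \<subseteq> U" using U u by (auto elim: openE)
    have "\<exists>k. \<forall>v\<in>ball u r. ?f v \<bullet> ?f v = k"
      using r(2) by (intro has_derivative_zero_constant convex_ball has_derivative_at_withinI[OF deriv]) blast
    then have "g q = g p" if "q \<in> \<phi> ` ball u r" for q
      using that r u by (auto simp: g_def)
    moreover have "p \<in> \<phi> ` ball u r" using r(1) u(2) by simp
    ultimately show ?thesis
      using openin_chart_image[OF chart open_ball r(2)] by blast
  qed
  obtain p where p: "p \<in> topspace M" using surf unfolding surface_def by blast
  obtain U \<phi> u where chart: "local_param M x U \<phi>" and u: "u \<in> U"
    using surf p unfolding surface_def by blast
  have const: "norm (x q - c) = norm (x p - c)" if "q \<in> topspace M" for q
    using connected_space_locally_constant[OF conn loc p that] by (simp add: g_def norm_eq)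
  \<comment> \<open>Radius zero would make the position vector constant.\<close>
  have "norm (x p - c) > 0"
    using const not_constant_on_chart[OF chart u, of c] by (force simp: constant_on_def)
  moreover have "x ` topspace M \<subseteq> sphere c (norm (x p - c))"
    using const by (auto simp: dist_norm norm_minus_commute)
  ultimately show ?thesis unfolding part_of_sphere_def by blast
qed

section \<open>From spheres to III-type 1\<close>

lemma part_of_sphere_imp_III_type_1:
  fixes M :: "'a topology" and x n :: "'a \<Rightarrow> real^3"
  assumes surf: "surface M x"
    and gauss: "gauss_map M x n" and K: "no_parabolic_points M x n"
    and sphere: "part_of_sphere M x"
  shows "III_type M x n 1"
proof -
  obtain c r where r: "r > 0" and "x ` topspace M \<subseteq> sphere c r"
    using sphere unfolding part_of_sphere_def by blast
  then have x: "\<And>p. p \<in> topspace M \<Longrightarrow> x p \<in> sphere c r" by blast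
  define f where "f p = x p - c" for p
  \<comment> \<open>The eigenvalue 2 is that of the unit normal in \<open>beltrami2_nu\<close>; it
    is independent of the radius.\<close>
  have "III_eigen M x n 2 f"
    unfolding III_eigen_def
  proof (intro allI impI conjI ballI)
    fix U \<phi> assume chart: "local_param M x U \<phi>"
    let ?f = "\<lambda>v. (x \<circ> \<phi>) v - c"
    have f_eq: "f \<circ> \<phi> = ?f" by (auto simp: f_def)
    show C2f: "Ck_on 2 (f \<circ> \<phi>) U"
      unfolding f_eq by (rule Ck_on_2_diff_const[OF chart])
    fix u assume u: "u \<in> U"
    note U = open_chart[OF chart]
    interpret spherical_immersion U "n \<circ> \<phi>"
      by (rule chart_spherical_immersion[OF chart gauss K])
    have norm: "?f v \<bullet> ?f v = r\<^sup>2" if "v \<in> U" for v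
      using x[OF chart_in_topspace[OF chart that]]
      by (simp add: dist_norm norm_minus_commute dot_square_norm)
    \<comment> \<open>Differentiating |x - c|^2 = r^2 shows that \<open>x - c\<close> is normal to
      the surface.\<close>
    have "?f v \<bullet> pd i (x \<circ> \<phi>) v = 0" if "v \<in> U" for v i
    proof -
      have "pd i (\<lambda>v. ?f v \<bullet> ?f v) v = 0"
        using pd_cong_open[OF U that norm] by simp
      then show ?thesis
        using pd_inner[OF Ck_on_2D(1) Ck_on_2D(1), OF C2f that C2f that, of i]
        unfolding f_eq pd_chart_diff_const[OF chart that] by (simp add: inner_commute)
    qed
    then have "?f v = r *\<^sub>R (n \<circ> \<phi>) v \<or> ?f v = - (r *\<^sub>R (n \<circ> \<phi>) v)" if "v \<in> U" for v
      using chart_normal_collinear[OF chart gauss that _ norm[OF that]] that by blast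
    moreover have "r *\<^sub>R (n \<circ> \<phi>) v \<noteq> 0" if "v \<in> U" for v
      using r unit[OF that] by auto
    moreover have "continuous_on U ?f" "continuous_on U (\<lambda>v. r *\<^sub>R (n \<circ> \<phi>) v)"
      using Ck_on_imp_continuous_on[OF C2f] continuous_chart_normal[OF chart gauss]
      unfolding f_eq by (auto intro: continuous_on_scaleR)
    \<comment> \<open>The sign between \<open>x - c\<close> and \<open>r\<close> times the normal is
      constant near \<open>u\<close>, which is enough for a differential operator evaluated at
      \<open>u\<close>.\<close>
    ultimately obtain V s where V: "open V" "u \<in> V" "V \<subseteq> U"
      "\<And>v. v \<in> V \<Longrightarrow> ?f v = s *\<^sub>R (r *\<^sub>R (n \<circ> \<phi>) v)"
      using sign_locally_constant[OF U u, of ?f "\<lambda>v. r *\<^sub>R (n \<circ> \<phi>) v"] by metis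
    have "beltrami2_vec (form3 (n \<circ> \<phi>)) ?f u
        = beltrami2_vec (form3 (n \<circ> \<phi>)) (\<lambda>v. (s * r) *\<^sub>R (n \<circ> \<phi>) v) u"
      by (rule beltrami2_vec_cong[OF V(1,2)]) (simp only: V(4) scaleR_scaleR)
    also have "\<dots> = (s * r) *\<^sub>R (2 *\<^sub>R (n \<circ> \<phi>) u)"
      by (simp only: beltrami2_vec_scaleR[OF U u C2] beltrami2_nu[OF u])
    also have "\<dots> = 2 *\<^sub>R ?f u"
      by (simp only: V(4)[OF V(2)] scaleR_scaleR) (simp add: mult_ac)
    finally show "beltrami2_vec (form3 (n \<circ> \<phi>)) (f \<circ> \<phi>) u = 2 *\<^sub>R f (\<phi> u)"
      unfolding f_eq by (simp add: f_def)
  qed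
  moreover have "\<not> f constant_on topspace M"
  proof -
    obtain p where p: "p \<in> topspace M" using surf unfolding surface_def by blast
    obtain U \<phi> u where chart: "local_param M x U \<phi>" and u: "u \<in> U"
      using surf p unfolding surface_def by blast
    show ?thesis using not_constant_on_chart[OF chart u, of c] by (simp add: f_def[abs_def])
  qed
  ultimately have "III_decomposition M x n 1 c (\<lambda>_. f) (\<lambda>_. 2)"
    by (auto simp: III_decomposition_def f_def inj_on_def)
  then show ?thesis unfolding III_type_def by (metis zero_neq_numeral)
qed

theorem theorem3p3:
  fixes M :: "'a topology" and x n :: "'a \<Rightarrow> real^3"
  assumes "surface M x"
    and "connected_space M"
    and "gauss_map M x n"
    and "no_parabolic_points M x n"
  shows "III_type M x n 1 \<longleftrightarrow> part_of_sphere M x"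
  using III_type_1_imp_part_of_sphere[OF assms] part_of_sphere_imp_III_type_1[OF assms(1,3,4)]
  by blast

end
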